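(* There is an absolute constant $c_0>0$ such that the following holds. Let $n\ge1$, $N=2^n$, let $C,D\in\mathbb{R}$ with $a_m:=C+mD\ge0$ for $0\le m\le N-1$, let $A=\mathrm{diag}(s_0,\dots,s_{N-1})$ with $s_m=a_m+i\,a_m$, and let $L=\frac{A+A^\dagger}{2}$ and $H=\frac{A-A^\dagger}{2i}$ (so $L=H$). Let $K,T>0$, $h_k=2K/N$, $h_t=T/N$, $k_j=-K+jh_k$ and $t_\ell=\ell h_t$ for $0\le j,\ell\le N-1$. Then the operator $$\mathrm{SEL}=\sum_{j=0}^{N-1}\sum_{\ell=0}^{N-1}|j\rangle\langle j|\otimes|\ell\rangle\langle\ell|\otimes e^{-it_\ell(k_jL+H)}$$ on $(\mathbb{C}^2)^{\otimes n}\otimes(\mathbb{C}^2)^{\otimes n}\otimes\mathbb{C}^{N}$ can be written as a product of at most $c_0(\log_2N)^2$ controlled unitaries, each of which applies a unitary on the third (target) register controlled by at most two qubits: at most one qubit of the first register and at most one qubit of the second register.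
   Context: The first and second registers consist of $n=\log_2 N$ qubits each, with $|j\rangle$, $|\ell\rangle$ the computational basis states labelled by the binary expansions $j=\sum_{a=0}^{n-1}2^aj_a$, $\ell=\sum_{b=0}^{n-1}2^b\ell_b$. A unitary $V$ on the target register controlled by a set $S$ of at most two qubits is the operator that acts as $V$ on the target when all qubits of $S$ are in state $|1\rangle$ and as the identity on the target when the computational basis state of the qubits in $S$ is any other one. *)

theory Defs
  imports Complex_Main "Jordan_Normal_Form.Schur_Decomposition"
begin

(* Kronecker product: the index of a basis vector e_i \<otimes> e_k is i * dim B + k. *)
definition kron :: "complex mat \<Rightarrow> complex mat \<Rightarrow> complex mat"  (infixl \<open>\<otimes>\<^sub>m\<close> 70)
  where "A \<otimes>\<^sub>m B =
    mat (dim_row A * dim_row B) (dim_col A * dim_col B)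
      (\<lambda>(r, c). A $$ (r div dim_row B, c div dim_col B) * B $$ (r mod dim_row B, c mod dim_col B))"

(* The dimension has to be supplied, as 'a mat has no zero element independent of the size. *)
definition matsum :: "nat \<Rightarrow> ('i \<Rightarrow> complex mat) \<Rightarrow> 'i set \<Rightarrow> complex mat"
  where "matsum d F I = mat d d (\<lambda>(r, c). \<Sum>i\<in>I. F i $$ (r, c))"

definition matprod :: "nat \<Rightarrow> complex mat list \<Rightarrow> complex mat"
  where "matprod d Us = foldr (*) Us (1\<^sub>m d)"

(* Sum of the exponential series, taken entry by entry. *)
definition mat_exp :: "complex mat \<Rightarrow> complex mat"
  where "mat_exp A =
    mat (dim_row A) (dim_row A) (\<lambda>(r, c). \<Sum>k. (A ^\<^sub>m k) $$ (r, c) / fact k)"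

definition unitary_mat :: "nat \<Rightarrow> complex mat \<Rightarrow> bool"
  where "unitary_mat d V \<longleftrightarrow>
    V \<in> carrier_mat d d \<and> mat_adjoint V * V = 1\<^sub>m d \<and> V * mat_adjoint V = 1\<^sub>m d"

(* |j><j| on the space with computational basis |0>, ..., |d - 1>. *)
definition basis_proj :: "nat \<Rightarrow> nat \<Rightarrow> complex mat"
  where "basis_proj d j = mat d d (\<lambda>(r, c). if r = j \<and> c = j then 1 else 0)"

(* Sum over j, l of |j><j| \<otimes> |l><l| \<otimes> U j l. *)
definition select_op :: "nat \<Rightarrow> (nat \<Rightarrow> nat \<Rightarrow> complex mat) \<Rightarrow> complex mat"
  where "select_op N U =
    matsum (N * N * N) (\<lambda>(j, l). basis_proj N j \<otimes>\<^sub>m basis_proj N l \<otimes>\<^sub>m U j l)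
      ({..<N} \<times> {..<N})"

(* Labels of the qubits of the first and of the second register.  The n-qubit space is identified
   with C^(2^n) through the labelling of its computational basis by binary expansions: in the basis
   state |j>, the qubit with label a is in the state given by the coefficient of 2^a in j. *)
datatype qubit = First nat | Second nat

fun qubit_is_one :: "nat \<Rightarrow> nat \<Rightarrow> qubit \<Rightarrow> bool" where
  "qubit_is_one j l (First a) = bit j a"
| "qubit_is_one j l (Second b) = bit l b"

definition controlled :: "nat \<Rightarrow> qubit set \<Rightarrow> complex mat \<Rightarrow> complex mat"
  where "controlled n S V =
    select_op (2 ^ n) (\<lambda>j l. if \<forall>q\<in>S. qubit_is_one j l q then V else 1\<^sub>m (2 ^ n))"

definition two_controlled_unitary :: "nat \<Rightarrow> complex mat \<Rightarrow> bool"
  where "two_controlled_unitary n U \<longleftrightarrow>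
    (\<exists>S V. S \<subseteq> First ` {..<n} \<union> Second ` {..<n} \<and> card S \<le> 2 \<and>
       card (S \<inter> range First) \<le> 1 \<and> card (S \<inter> range Second) \<le> 1 \<and>
       unitary_mat (2 ^ n) V \<and> U = controlled n S V)"

end

theory Submission
  imports Defs
begin

text \<open>
  Every operator in sight is diagonal, so composing gates amounts to adding phases.  In the basis
  state with labels j, l, m the phase of SEL is -t l * (k j + 1) * a m; expanding j and l in binary
  turns it into a sum of n terms controlled by one bit of l and n * n terms controlled by one
  bit of j and one bit of l.  Hence n + n * n gates suffice.
\<close>

lemma adjoint_mat_diag: "mat_adjoint (mat_diag d f) = mat_diag d (\<lambda>i. cnj (f i))"
  by (rule eq_matI) (auto simp: mat_adjoint_def mat_diag_def mat_of_rows_def)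

lemma unitary_mat_diag:
  assumes "\<And>i. cmod (f i) = 1"
  shows "unitary_mat d (mat_diag d f)"
proof -
  have "f i * cnj (f i) = 1" for i
    using complex_norm_square[of "f i"] assms[of i] by simp
  then show ?thesis
    by (simp add: unitary_mat_def adjoint_mat_diag mult.commute)
qed

lemma smult_mat_diag: "c \<cdot>\<^sub>m mat_diag d f = mat_diag d (\<lambda>i. c * f i :: complex)"
  by (rule eq_matI) (auto simp: mat_diag_def)

lemma add_mat_diag: "mat_diag d f + mat_diag d g = mat_diag d (\<lambda>i. f i + g i :: complex)"
  by (rule eq_matI) (auto simp: mat_diag_def)

lemma minus_mat_diag: "mat_diag d f - mat_diag d g = mat_diag d (\<lambda>i. f i - g i :: complex)"
  by (rule eq_matI) (auto simp: mat_diag_def)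

lemma pow_mat_diag: "mat_diag d f ^\<^sub>m k = mat_diag d (\<lambda>i. f i ^ k :: complex)"
proof (induction k)
  case 0
  show ?case by (simp add: mat_diag_def one_mat_def)
next
  case (Suc k)
  then show ?case by (simp add: mult.commute)
qed

lemma mat_exp_mat_diag: "mat_exp (mat_diag d f) = mat_diag d (\<lambda>i. exp (f i))"
proof (rule eq_matI)
  fix r c assume "r < dim_row (mat_diag d (\<lambda>i. exp (f i)))" "c < dim_col (mat_diag d (\<lambda>i. exp (f i)))"
  then have rc: "r < d" "c < d" by (auto simp: mat_diag_def)
  have "mat_exp (mat_diag d f) $$ (r, c) = (\<Sum>k. (if r = c then f c ^ k else 0) / fact k)"
    using rc unfolding mat_exp_def pow_mat_diag by (simp add: mat_diag_def)
  also have "\<dots> = (if r = c then exp (f c) else 0)"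
    by (simp add: exp_def scaleR_conv_of_real divide_inverse mult.commute)
  finally show "mat_exp (mat_diag d f) $$ (r, c) = mat_diag d (\<lambda>i. exp (f i)) $$ (r, c)"
    using rc by (simp add: mat_diag_def)
qed (auto simp: mat_exp_def mat_diag_def)

text \<open>Here \<open>h\<close> and \<open>h'\<close> are the step widths of k and t. As L and H
  are the same diagonal matrix, k j * L + H has the entries (k j + 1) * a m, and k j + 1 = (1 - K) +
  h * j. The sign and \<open>h'\<close> are moved into the factor that depends on m, so that what
  remains is linear in l and affine in j.\<close>

lemma mat_exp_phase:
  fixes K h h' :: real and a :: "nat \<Rightarrow> real"
  shows "mat_exp ((- \<i> * complex_of_real (real l * h')) \<cdot>\<^sub>m
      (complex_of_real (- K + real j * h) \<cdot>\<^sub>m mat_diag N (\<lambda>m. of_real (a m)) +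
        mat_diag N (\<lambda>m. of_real (a m)))) =
    mat_diag N (\<lambda>m. cis (real l * ((1 - K) + h * real j) * (- h' * a m)))"
  unfolding smult_mat_diag add_mat_diag mat_exp_mat_diag cis_conv_exp
  by (intro arg_cong[of _ _ "mat_diag N"] ext arg_cong[of _ _ exp]) (simp add: algebra_simps)

text \<open>With the index convention of the Kronecker product, r = (j * N + l) * N + m, so j, l and
  m are the base-N digits of r. The two projectors leave only the summand whose j and l are these
  digits.\<close>

lemma select_op_mat_diag:
  "select_op N (\<lambda>j l. mat_diag N (g j l)) =
    mat_diag (N * N * N) (\<lambda>r. g (r div N div N) (r div N mod N) (r mod N))"
proof (rule eq_matI)
  fix r c
  assume "r < dim_row (mat_diag (N * N * N) (\<lambda>r. g (r div N div N) (r div N mod N) (r mod N)))"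
    and "c < dim_col (mat_diag (N * N * N) (\<lambda>r. g (r div N div N) (r div N mod N) (r mod N)))"
  then have rc: "r < N * N * N" "c < N * N * N" by (auto simp: mat_diag_def)
  then have N: "N > 0" by (cases N) auto
  have bound: "x div N < N * N" "x div N div N < N" "x div N mod N < N" "x mod N < N"
    if "x < N * N * N" for x
    using that N by (simp_all add: less_mult_imp_div_less)
  let ?G = "\<lambda>(j, l). if r div N div N = j \<and> c div N div N = j \<and> r div N mod N = l \<and> c div N mod N = l
    \<and> r mod N = c mod N then g j l (c mod N) else 0"
  \<comment> \<open>An index is determined by its three base-N digits, hence nonzero entries lie on
    the diagonal.\<close>
  have eq: "c div N div N = r div N div N \<and> c div N mod N = r div N mod N \<and> r mod N = c mod N \<longleftrightarrow> r = c"
    by (metis div_mult_mod_eq)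
  have "select_op N (\<lambda>j l. mat_diag N (g j l)) $$ (r, c) = (\<Sum>p\<in>{..<N} \<times> {..<N}. ?G p)"
    unfolding select_op_def matsum_def using rc bound[OF rc(1)] bound[OF rc(2)]
    by (auto intro!: sum.cong simp: kron_def basis_proj_def mat_diag_def split: prod.splits)
  also have "\<dots> = (\<Sum>p\<in>{..<N} \<times> {..<N}. if p = (r div N div N, r div N mod N) then
      (if r = c then g (r div N div N) (r div N mod N) (r mod N) else 0) else 0)"
    using eq by (intro sum.cong refl, cases "r = c") (auto split: if_splits)
  also have "\<dots> = (if r = c then g (r div N div N) (r div N mod N) (r mod N) else 0)"
    using bound[OF rc(1)] by (subst sum.delta) auto
  finally show "select_op N (\<lambda>j l. mat_diag N (g j l)) $$ (r, c) =
      mat_diag (N * N * N) (\<lambda>r. g (r div N div N) (r div N mod N) (r mod N)) $$ (r, c)"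
    using rc by (simp add: mat_diag_def)
qed (auto simp: select_op_def matsum_def mat_diag_def)

lemma controlled_mat_diag:
  assumes "N = 2 ^ n"
  shows "controlled n S (mat_diag N f) = mat_diag (N * N * N)
    (\<lambda>r. if \<forall>q\<in>S. qubit_is_one (r div N div N) (r div N mod N) q then f (r mod N) else 1)"
proof -
  \<comment> \<open>The identity is diagonal with entries 1, so both branches of the control are a
    single \<open>mat_diag\<close>.\<close>
  have "(if P then mat_diag N f else 1\<^sub>m N) = mat_diag N (\<lambda>m. if P then f m else 1)" for P
    by simp
  then show ?thesis
    unfolding controlled_def assms[symmetric] by (simp only: select_op_mat_diag)
qed

lemma matprod_mat_diag:
  "matprod d (map (\<lambda>x. mat_diag d (f x)) xs) = mat_diag d (\<lambda>i. prod_list (map (\<lambda>x. f x i) xs))"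
  by (induction xs) (simp_all add: matprod_def)

lemma prod_list_cis: "prod_list (map (\<lambda>x. cis (f x)) xs) = cis (sum_list (map f xs))"
  by (induction xs) (simp_all add: cis_mult)

lemma sum_bits_eq:
  assumes "j < 2 ^ n"
  shows "(\<Sum>a<n. 2 ^ a * of_bool (bit j a)) = real j"
proof -
  \<comment> \<open>The bound on j makes \<open>take_bit n\<close> fix j, so its lowest n bits give
    all of it.\<close>
  have "j = (\<Sum>a<n. 2 ^ a * of_bool (bit j a))"
    using take_bit_sum[of n j] assms
    by (simp add: take_bit_nat_eq_self push_bit_eq_mult atLeast0LessThan mult.commute)
  then have "real j = real (\<Sum>a<n. 2 ^ a * of_bool (bit j a))" by simp
  then show ?thesis by simp
qed

lemma two_controlled_unitary_cis:
  assumes "N = 2 ^ n" and "a < n" and "b < n"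
  shows "two_controlled_unitary n (controlled n {Second b} (mat_diag N (\<lambda>m. cis (f m))))"
    and "two_controlled_unitary n (controlled n {First a, Second b} (mat_diag N (\<lambda>m. cis (f m))))"
proof -
  have unitary: "unitary_mat (2 ^ n) (mat_diag N (\<lambda>m. cis (f m)))"
    unfolding assms(1) by (rule unitary_mat_diag) simp
  have "{First a, Second b} \<inter> range First = {First a}" "{First a, Second b} \<inter> range Second = {Second b}"
    "{Second b} \<inter> range First = {}" "{Second b} \<inter> range Second = {Second b}"
    by auto
  note card = this[THEN arg_cong, of card]
  show "two_controlled_unitary n (controlled n {Second b} (mat_diag N (\<lambda>m. cis (f m))))"
    unfolding two_controlled_unitary_def using unitary card assms
    by (intro exI[of _ "{Second b}"] exI[of _ "mat_diag N (\<lambda>m. cis (f m))"]) auto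
  show "two_controlled_unitary n (controlled n {First a, Second b} (mat_diag N (\<lambda>m. cis (f m))))"
    unfolding two_controlled_unitary_def using unitary card assms
    by (intro exI[of _ "{First a, Second b}"] exI[of _ "mat_diag N (\<lambda>m. cis (f m))"]) auto
qed

text \<open>A product of bits is the indicator that all the corresponding qubits are one, which is
  exactly a control condition. Every term of the expansion contains a bit of l, so no gate is
  controlled by the first register alone.\<close>

lemma select_op_cis_bilinear:
  fixes \<alpha> \<beta> :: real and \<phi> :: "nat \<Rightarrow> real"
  assumes N: "N = 2 ^ n"
  shows "\<exists>Us. length Us = n + n * n \<and> (\<forall>U\<in>set Us. two_controlled_unitary n U) \<and>
    select_op N (\<lambda>j l. mat_diag N (\<lambda>m. cis (real l * (\<alpha> + \<beta> * real j) * \<phi> m)))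
      = matprod (N * N * N) Us"
proof -
  \<comment> \<open>A gate is encoded by its control set and the coefficient of \<phi> in its phase.
    The first list comes from \<alpha>, the second from \<beta>.\<close>
  define ps where "ps = map (\<lambda>b. ({Second b}, 2 ^ b * \<alpha>)) [0..<n] @
    map (\<lambda>(a, b). ({First a, Second b}, 2 ^ b * (\<beta> * 2 ^ a))) (List.product [0..<n] [0..<n])"
  define Us where "Us = map (\<lambda>(S, x). controlled n S (mat_diag N (\<lambda>m. cis (x * \<phi> m)))) ps"
  \<comment> \<open>The phase that a gate contributes at the basis index r.\<close>
  define act where "act = (\<lambda>r (S, x). if \<forall>q\<in>S. qubit_is_one (r div N div N) (r div N mod N) q
    then x * \<phi> (r mod N) else 0)"
  have "length Us = n + n * n" by (simp add: Us_def ps_def)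
  moreover have "\<forall>U\<in>set Us. two_controlled_unitary n U"
    using two_controlled_unitary_cis[OF N] by (auto simp: Us_def ps_def)
  moreover have "select_op N (\<lambda>j l. mat_diag N (\<lambda>m. cis (real l * (\<alpha> + \<beta> * real j) * \<phi> m)))
      = matprod (N * N * N) Us"
  proof -
    \<comment> \<open>An inactive gate contributes the factor 1 = \<open>cis 0\<close>, so every
      gate has the form \<open>cis\<close> of a phase and the product becomes a sum.\<close>
    have "Us = map (\<lambda>p. mat_diag (N * N * N) (\<lambda>r. cis (act r p))) ps"
      unfolding Us_def act_def by (auto simp: controlled_mat_diag[OF N] intro!: arg_cong[of _ _ "mat_diag _"])
    then have prod: "matprod (N * N * N) Us = mat_diag (N * N * N) (\<lambda>r. cis (\<Sum>p\<leftarrow>ps. act r p))"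
      by (simp add: matprod_mat_diag prod_list_cis)
    have phase: "(\<Sum>p\<leftarrow>ps. act r p) =
        real (r div N mod N) * (\<alpha> + \<beta> * real (r div N div N)) * \<phi> (r mod N)"
      if "r < N * N * N" for r
    proof -
      let ?j = "r div N div N" and ?l = "r div N mod N" and ?m = "r mod N"
      have less: "?j < 2 ^ n" "?l < 2 ^ n"
        using that by (simp_all add: N less_mult_imp_div_less)
      let ?J = "\<lambda>a. 2 ^ a * of_bool (bit ?j a) :: real" and ?L = "\<lambda>b. 2 ^ b * of_bool (bit ?l b) :: real"
      \<comment> \<open>The conditionals turn into factors \<open>of_bool\<close>; the lists of
        labels are distinct, so list sums become sums over sets.\<close>
      have "(\<Sum>p\<leftarrow>ps. act r p) = (\<Sum>b<n. ?L b * \<alpha> * \<phi> ?m) +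
          (\<Sum>(a, b)\<in>{..<n} \<times> {..<n}. ?L b * (\<beta> * ?J a) * \<phi> ?m)"
        by (auto simp: ps_def act_def o_def case_prod_beta sum_list_distinct_conv_sum_set distinct_product
            atLeast0LessThan intro!: arg_cong2[of _ _ _ _ "(+)"] sum.cong)
      also have "\<dots> = (\<Sum>b<n. ?L b) * \<alpha> * \<phi> ?m + (\<Sum>b<n. ?L b) * (\<beta> * (\<Sum>a<n. ?J a)) * \<phi> ?m"
        unfolding sum.cartesian_product[symmetric] sum_distrib_left sum_distrib_right ..
      also have "\<dots> = real ?l * (\<alpha> + \<beta> * real ?j) * \<phi> ?m"
        unfolding sum_bits_eq[OF less(1)] sum_bits_eq[OF less(2)] by (simp add: algebra_simps)
      finally show ?thesis .
    qed
    show ?thesis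
      \<comment> \<open>The diagonals are compared entry by entry because \<open>phase\<close> holds
        only for indices below N * N * N.\<close>
      unfolding select_op_mat_diag prod by (rule eq_matI) (auto simp: mat_diag_def phase)
  qed
  ultimately show ?thesis by blast
qed

theorem lemma1:
  shows "\<exists>c0::real. c0 > 0 \<and>
    (\<forall>(n::nat) (C::real) (D::real) (K::real) (T::real).
      n \<ge> 1 \<longrightarrow> (\<forall>m \<le> 2 ^ n - 1. C + real m * D \<ge> 0) \<longrightarrow> K > 0 \<longrightarrow> T > 0 \<longrightarrow>
      (let N = (2 ^ n :: nat);
           a = (\<lambda>m::nat. C + real m * D);
           s = (\<lambda>m. complex_of_real (a m) + \<i> * complex_of_real (a m));
           A = mat_diag N s;
           L = (1 / 2) \<cdot>\<^sub>m (A + mat_adjoint A);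
           H = (1 / (2 * \<i>)) \<cdot>\<^sub>m (A - mat_adjoint A);
           hk = 2 * K / real N;
           ht = T / real N;
           k = (\<lambda>j::nat. - K + real j * hk);
           t = (\<lambda>l::nat. real l * ht);
           SEL = select_op N (\<lambda>j l.
             mat_exp ((- \<i> * complex_of_real (t l)) \<cdot>\<^sub>m (complex_of_real (k j) \<cdot>\<^sub>m L + H)))
       in \<exists>Us. real (length Us) \<le> c0 * (log 2 (real N))\<^sup>2 \<and>
            (\<forall>U \<in> set Us. two_controlled_unitary n U) \<and>
            SEL = matprod (N * N * N) Us))"
proof (intro exI[of _ "2::real"] conjI allI impI, unfold Let_def, goal_cases)
  case 1
  show ?case by simp
next
  case (2 n C D K T)
  let ?N = "2 ^ n :: nat"
  let ?a = "\<lambda>m::nat. C + real m * D"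
  let ?s = "\<lambda>m. complex_of_real (?a m) + \<i> * complex_of_real (?a m)"
  \<comment> \<open>L and H carry the real and the imaginary parts of the entries s m, and both
    parts are a m.\<close>
  have L: "(1 / 2) \<cdot>\<^sub>m (mat_diag ?N ?s + mat_adjoint (mat_diag ?N ?s)) = mat_diag ?N (\<lambda>m. of_real (?a m))"
    unfolding adjoint_mat_diag add_mat_diag smult_mat_diag
    by (intro arg_cong[of _ _ "mat_diag ?N"] ext) simp
  have H: "(1 / (2 * \<i>)) \<cdot>\<^sub>m (mat_diag ?N ?s - mat_adjoint (mat_diag ?N ?s)) = mat_diag ?N (\<lambda>m. of_real (?a m))"
    unfolding adjoint_mat_diag minus_mat_diag smult_mat_diag
    by (intro arg_cong[of _ _ "mat_diag ?N"] ext) simp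
  obtain Us where Us: "length Us = n + n * n" "\<forall>U\<in>set Us. two_controlled_unitary n U"
    "select_op ?N (\<lambda>j l. mat_diag ?N (\<lambda>m. cis (real l * ((1 - K) + 2 * K / real ?N * real j) * (- (T / real ?N) * ?a m))))
      = matprod (?N * ?N * ?N) Us"
    using select_op_cis_bilinear[OF refl, of n "1 - K" "2 * K / real ?N" "\<lambda>m. - (T / real ?N) * ?a m"] by blast
  \<comment> \<open>The constant 2 comes from n \<le> n * n for natural numbers, together with log 2
    N = n.\<close>
  have "real (n + n * n) \<le> real (2 * (n * n))"
    unfolding of_nat_le_iff by simp
  then have "real (length Us) \<le> 2 * (log 2 (real ?N))\<^sup>2"
    unfolding Us(1) by (simp add: log_nat_power power2_eq_square)
  then show ?case
    using Us(2,3) unfolding L H mat_exp_phase by blast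
qed

end
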